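(* Let $(\mathcal X,\mathcal X^\Omega)$ be a standard quasi-universal space. Then there is the equality of quasi-universal spaces (underlying sets and admissible random variables) $$\mathsf G(\mathcal X,\mathcal X^\Omega)=\mathsf Q(\mathcal X,\mathcal X^\Omega)=\mathsf P(\mathcal X,\mathcal X^\Omega)=\mathsf K(\mathcal X,\mathcal X^\Omega)=\mathsf R(\mathcal X,\mathcal X^\Omega)=\mathsf S(\mathcal X,\mathcal X^\Omega).$$ Furthermore, $\mathsf G(\mathcal X,\mathcal X^\Omega)$ is also a standard quasi-universal space.
   Context: Fix the sample space: $\Omega=[0,1]^{\mathbb N}$, $\mathcal B_\Omega$ the $\sigma$-algebra of all universally measurable subsets of $\Omega$, $\Omega^\Omega$ the set of all measurable maps $(\Omega,\mathcal B_\Omega)\to(\Omega,\mathcal B_\Omega)$. A quasi-universal space is a pair $(\mathcal X,\mathcal X^\Omega)$ of a set and a set $\mathcal X^\Omega$ of maps $\Omega\to\mathcal X$ (admissible random variables) containing all constants and closed under $X\mapsto X\circ\Phi$, $\Phi\in\Omega^\Omega$; $g:\mathcal X\to\mathcal Y$ is quasi-measurable if $g\circ\mathcal X^\Omega\subseteq\mathcal Y^\Omega$; products carry componentwise structure. It is standard if $\mathcal X=\emptyset$ or there are quasi-measurable maps $i:\mathcal X\to\Omega$, $r:\Omega\to\mathcal X$ with $r\circ i=\mathrm{id}_{\mathcal X}$. $(\mathcal X^\Omega)^\Omega$ is the set of maps $X:\Omega\to\mathcal X^\Omega$ with $(\omega,\omega')\mapsto X(\omega)(\omega')$ quasi-measurable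 $\Omega\times\Omega\to\mathcal X$; likewise $(\Omega^\Omega)^\Omega$. The induced $\sigma$-algebra is $\mathcal B_{\mathcal X}=\{A\subseteq\mathcal X\mid X^{-1}(A)\in\mathcal B_\Omega\ \forall X\in\mathcal X^\Omega\}$; $\mathcal B_{\Omega\times\mathcal X}$ is that of the product. For $D\subseteq\Omega\times\mathcal X$, $D_\omega=\{x\mid(\omega,x)\in D\}$. Quasi-universal spaces of probability measures on $\mathcal B_{\mathcal X}$: - $\mathsf G(\mathcal X)$: all probability measures on $(\mathcal X,\mathcal B_{\mathcal X})$; admissible random variables: all $\kappa:\Omega\to\mathsf G(\mathcal X)$ with $\omega\mapsto\kappa(\omega)(A)$ $\mathcal B_\Omega$-measurable for all $A\in\mathcal B_{\mathcal X}$. - $\mathsf Q(\mathcal X)$: those $\mu\in\mathsf G(\mathcal X)$ for which $\omega\mapsto\mu(D_\omega)$ is $\mathcal B_\Omega$-measurable for all $D\in\mathcal B_{\Omega\times\mathcal X}$; admissible random variables: all $\kappa:\Omega\to\mathsf Q(\mathcal X)$ with $\omega\mapsto\kappa(\Phi(\omega))(D_\omega)$ $\mathcal B_\Omega$-measurable for all $\Phi\in\Omega^\Omega$, $D\in\mathcal B_{\Omega\times\mathcal X}$. - $\mathsf K(\mathcal X)$ and $\mathsf R(\mathcal X)$: underlying set $\{X_*\mu\mid X\in\mathcal X^\Omega,\mu\in\mathsf Q(\Omega)\}$; $\mathsf K(\mathcal X)^\Omega$ consists of all $\omega\mapsto X(\omega)_*\kappa(\omega)$ with $X\in(\mathcal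 X^\Omega)^\Omega$, $\kappa\in\mathsf Q(\Omega)^\Omega$; $\mathsf R(\mathcal X)^\Omega$ of all $\omega\mapsto X_*\kappa(\omega)$ with $X\in\mathcal X^\Omega$, $\kappa\in\mathsf Q(\Omega)^\Omega$. - $\mathsf P(\mathcal X)$ and $\mathsf S(\mathcal X)$: underlying set $\{X_*P\mid X\in\mathcal X^\Omega,P\in\mathsf G(\Omega)\}$; $\mathsf P(\mathcal X)^\Omega$ consists of all $\omega\mapsto X(\omega)_*P$ with $X\in(\mathcal X^\Omega)^\Omega$, $P\in\mathsf G(\Omega)$; $\mathsf S(\mathcal X)^\Omega$ of all $\omega\mapsto X_*\phi(\omega)_*P$ with $X\in\mathcal X^\Omega$, $\phi\in(\Omega^\Omega)^\Omega$, $P\in\mathsf G(\Omega)$. All push-forwards are restricted to $\mathcal B_{\mathcal X}$. *)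

theory Defs
  imports "HOL-Probability.Probability"
begin

typedef omega = "{w :: nat \<Rightarrow> real. \<forall>n. w n \<in> {0..1}}"
  by (rule exI[of _ "\<lambda>_. 0"]) simp

text \<open>The trace on the Hilbert cube of the Borel sets of the product topology on
  \<^typ>\<open>nat \<Rightarrow> real\<close>, i.e. its Borel sets for the product topology.\<close>

definition borel_omega :: "omega measure" where
  "borel_omega = vimage_algebra UNIV Rep_omega borel"

text \<open>Universally measurable sets: those in the completion of every Borel probability measure.
  Here and below the family given to \<open>sigma\<close>
  is already a sigma-algebra.\<close>

definition univ_measurable :: "'a measure \<Rightarrow> 'a measure" where
  "univ_measurable M = sigma (space M)
     {A. A \<subseteq> space M \<and>
         (\<forall>\<mu>. prob_space \<mu> \<and> sets \<mu> = sets M \<longrightarrow> A \<in> sets (completion \<mu>))}"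

lemma sets_univ_measurable:
  "sets (univ_measurable M) =
     {A. A \<subseteq> space M \<and>
         (\<forall>\<mu>. prob_space \<mu> \<and> sets \<mu> = sets M \<longrightarrow> A \<in> sets (completion \<mu>))}" (is "_ = ?S")
proof -
  have "sigma_algebra (space M) ?S"
  proof (rule sigma_algebra_iff2[THEN iffD2], intro conjI ballI allI impI)
    show "?S \<subseteq> Pow (space M)" by auto
    show "{} \<in> ?S" by auto
  next
    fix s assume s: "s \<in> ?S"
    have "space M - s \<in> sets (completion \<mu>)" if "prob_space \<mu>" "sets \<mu> = sets M" for \<mu>
      using s that sets_eq_imp_space_eq[OF that(2)] sets.compl_sets[of s "completion \<mu>"] by auto
    then show "space M - s \<in> ?S" by auto
  next
    fix A :: "nat \<Rightarrow> _" assume "range A \<subseteq> ?S"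
    then show "(\<Union>i. A i) \<in> ?S" by (auto intro!: sets.countable_UN)
  qed
  then show ?thesis
    unfolding univ_measurable_def by (rule sigma_algebra.sets_measure_of_eq)
qed

lemma space_univ_measurable [simp]: "space (univ_measurable M) = space M"
  by (simp add: univ_measurable_def space_measure_of_conv)

abbreviation B_omega :: "omega measure" where
  "B_omega \<equiv> univ_measurable borel_omega"

lemma space_borel_omega [simp]: "space borel_omega = UNIV"
  by (simp add: borel_omega_def)

text \<open>Underlying set and admissible random variables.  Since \<^typ>\<open>omega\<close> is a type, maps out of
  it are total functions, so that equality of these pairs is equality of quasi-universal spaces.\<close>

type_synonym 'a qus = "'a set \<times> (omega \<Rightarrow> 'a) set"

abbreviation qcarrier :: "'a qus \<Rightarrow> 'a set" where
  "qcarrier \<equiv> fst"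

abbreviation rvs :: "'a qus \<Rightarrow> (omega \<Rightarrow> 'a) set" where
  "rvs \<equiv> snd"

definition quasi_universal_space :: "'a qus \<Rightarrow> bool" where
  "quasi_universal_space X \<longleftrightarrow>
     rvs X \<subseteq> UNIV \<rightarrow> qcarrier X \<and>
     (\<forall>x\<in>qcarrier X. (\<lambda>_. x) \<in> rvs X) \<and>
     (\<forall>\<alpha>\<in>rvs X. \<forall>\<Phi>\<in>B_omega \<rightarrow>\<^sub>M B_omega. \<alpha> \<circ> \<Phi> \<in> rvs X)"

definition qmeasurable :: "'a qus \<Rightarrow> 'b qus \<Rightarrow> ('a \<Rightarrow> 'b) set" where
  "qmeasurable X Y = {g \<in> qcarrier X \<rightarrow> qcarrier Y. \<forall>\<alpha>\<in>rvs X. g \<circ> \<alpha> \<in> rvs Y}"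

definition omega_qus :: "omega qus" where
  "omega_qus = (UNIV, B_omega \<rightarrow>\<^sub>M B_omega)"

definition prod_qus :: "'a qus \<Rightarrow> 'b qus \<Rightarrow> ('a \<times> 'b) qus" where
  "prod_qus X Y =
     (qcarrier X \<times> qcarrier Y, {\<alpha>. fst \<circ> \<alpha> \<in> rvs X \<and> snd \<circ> \<alpha> \<in> rvs Y})"

definition standard_qus :: "'a qus \<Rightarrow> bool" where
  "standard_qus X \<longleftrightarrow> quasi_universal_space X \<and>
     (qcarrier X = {} \<or>
      (\<exists>i\<in>qmeasurable X omega_qus. \<exists>r\<in>qmeasurable omega_qus X. \<forall>x\<in>qcarrier X. r (i x) = x))"

text \<open>The admissible random variables of the space of maps from the sample space to \<open>X\<close>.\<close>

definition fun_rvs :: "'a qus \<Rightarrow> (omega \<Rightarrow> omega \<Rightarrow> 'a) set" where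
  "fun_rvs X = {F. (\<forall>\<omega>. F \<omega> \<in> rvs X) \<and>
     (\<lambda>(\<omega>, \<omega>'). F \<omega> \<omega>') \<in> qmeasurable (prod_qus omega_qus omega_qus) X}"

definition induced :: "'a qus \<Rightarrow> 'a measure" where
  "induced X = sigma (qcarrier X)
     {A. A \<subseteq> qcarrier X \<and> (\<forall>\<alpha>\<in>rvs X. \<alpha> -` A \<in> sets B_omega)}"

lemma space_induced [simp]: "space (induced X) = qcarrier X"
  by (simp add: induced_def space_measure_of_conv)

lemma sets_induced:
  assumes "quasi_universal_space X"
  shows "sets (induced X) = {A. A \<subseteq> qcarrier X \<and> (\<forall>\<alpha>\<in>rvs X. \<alpha> -` A \<in> sets B_omega)}"
    (is "_ = ?S")
proof -
  have sub: "\<alpha> \<omega> \<in> qcarrier X" if "\<alpha> \<in> rvs X" for \<alpha> \<omega>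
    using assms that by (auto simp: quasi_universal_space_def)
  have "sigma_algebra (qcarrier X) ?S"
  proof (rule sigma_algebra_iff2[THEN iffD2], intro conjI ballI allI impI)
    show "?S \<subseteq> Pow (qcarrier X)" by blast
    show "{} \<in> ?S" by simp
  next
    fix s assume s: "s \<in> ?S"
    have "\<alpha> -` (qcarrier X - s) \<in> sets B_omega" if "\<alpha> \<in> rvs X" for \<alpha>
    proof -
      have "\<alpha> -` (qcarrier X - s) = space B_omega - \<alpha> -` s"
        using sub[OF that] by auto
      also have "\<dots> \<in> sets B_omega"
        by (rule sets.compl_sets) (use s that in blast)
      finally show ?thesis .
    qed
    then show "qcarrier X - s \<in> ?S" by blast
  next
    fix A :: "nat \<Rightarrow> _" assume A: "range A \<subseteq> ?S"
    have "\<alpha> -` (\<Union>i. A i) \<in> sets B_omega" if "\<alpha> \<in> rvs X" for \<alpha>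
      unfolding vimage_UN by (rule sets.countable_UN) (use A that in blast)
    then show "(\<Union>i. A i) \<in> ?S" using A by blast
  qed
  then show ?thesis
    unfolding induced_def by (rule sigma_algebra.sets_measure_of_eq)
qed

lemma quasi_universal_omega: "quasi_universal_space omega_qus"
proof -
  have "(\<lambda>_. x) \<in> B_omega \<rightarrow>\<^sub>M B_omega" for x
    by (rule measurable_const) simp
  moreover have "\<alpha> \<circ> \<Phi> \<in> B_omega \<rightarrow>\<^sub>M B_omega"
    if "\<alpha> \<in> B_omega \<rightarrow>\<^sub>M B_omega" "\<Phi> \<in> B_omega \<rightarrow>\<^sub>M B_omega" for \<alpha> \<Phi>
    using that(2,1) by (rule measurable_comp)
  ultimately show ?thesis
    unfolding quasi_universal_space_def omega_qus_def fst_conv snd_conv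
    by (intro conjI ballI subsetI Pi_I UNIV_I)
qed

lemma sets_induced_omega: "sets (induced omega_qus) = sets B_omega"
proof (rule set_eqI)
  fix A
  have "A \<in> sets (induced omega_qus) \<longleftrightarrow>
      (\<forall>\<alpha>\<in>B_omega \<rightarrow>\<^sub>M B_omega. \<alpha> -` A \<in> sets B_omega)"
    unfolding sets_induced[OF quasi_universal_omega] by (simp only: omega_qus_def) simp
  also have "\<dots> \<longleftrightarrow> A \<in> sets B_omega"
  proof
    assume *: "\<forall>\<alpha>\<in>B_omega \<rightarrow>\<^sub>M B_omega. \<alpha> -` A \<in> sets B_omega"
    show "A \<in> sets B_omega"
      using bspec[OF * measurable_ident] by (simp only: vimage_id id_apply)
  next
    assume A: "A \<in> sets B_omega"
    show "\<forall>\<alpha>\<in>B_omega \<rightarrow>\<^sub>M B_omega. \<alpha> -` A \<in> sets B_omega"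
    proof
      fix \<alpha> assume "\<alpha> \<in> B_omega \<rightarrow>\<^sub>M B_omega"
      from measurable_sets[OF this A] show "\<alpha> -` A \<in> sets B_omega"
        by (simp only: space_univ_measurable space_borel_omega Int_UNIV_right)
    qed
  qed
  finally show "A \<in> sets (induced omega_qus) \<longleftrightarrow> A \<in> sets B_omega" .
qed

definition push :: "'a qus \<Rightarrow> (omega \<Rightarrow> 'a) \<Rightarrow> omega measure \<Rightarrow> 'a measure" where
  "push X \<alpha> \<mu> = distr \<mu> (induced X) \<alpha>"

text \<open>In the following spaces, \<open>Pair \<omega> -` D\<close> is the section of \<open>D\<close> at \<open>\<omega>\<close>.\<close>

definition G_space :: "'a qus \<Rightarrow> 'a measure qus" where
  "G_space X =
     (let C = {\<mu>. prob_space \<mu> \<and> sets \<mu> = sets (induced X)} in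
      (C, {\<kappa>. (\<forall>\<omega>. \<kappa> \<omega> \<in> C) \<and>
             (\<forall>A\<in>sets (induced X). (\<lambda>\<omega>. measure (\<kappa> \<omega>) A) \<in> borel_measurable B_omega)}))"

definition Q_space :: "'a qus \<Rightarrow> 'a measure qus" where
  "Q_space X =
     (let C = {\<mu> \<in> qcarrier (G_space X). \<forall>D\<in>sets (induced (prod_qus omega_qus X)).
                 (\<lambda>\<omega>. measure \<mu> (Pair \<omega> -` D)) \<in> borel_measurable B_omega} in
      (C, {\<kappa>. (\<forall>\<omega>. \<kappa> \<omega> \<in> C) \<and>
             (\<forall>\<Phi>\<in>B_omega \<rightarrow>\<^sub>M B_omega. \<forall>D\<in>sets (induced (prod_qus omega_qus X)).
                (\<lambda>\<omega>. measure (\<kappa> (\<Phi> \<omega>)) (Pair \<omega> -` D)) \<in> borel_measurable B_omega)}))"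

definition K_space :: "'a qus \<Rightarrow> 'a measure qus" where
  "K_space X =
     ({push X \<alpha> \<mu> | \<alpha> \<mu>. \<alpha> \<in> rvs X \<and> \<mu> \<in> qcarrier (Q_space omega_qus)},
      {(\<lambda>\<omega>. push X (F \<omega>) (\<kappa> \<omega>)) | F \<kappa>. F \<in> fun_rvs X \<and> \<kappa> \<in> rvs (Q_space omega_qus)})"

definition R_space :: "'a qus \<Rightarrow> 'a measure qus" where
  "R_space X =
     ({push X \<alpha> \<mu> | \<alpha> \<mu>. \<alpha> \<in> rvs X \<and> \<mu> \<in> qcarrier (Q_space omega_qus)},
      {(\<lambda>\<omega>. push X \<alpha> (\<kappa> \<omega>)) | \<alpha> \<kappa>. \<alpha> \<in> rvs X \<and> \<kappa> \<in> rvs (Q_space omega_qus)})"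

definition P_space :: "'a qus \<Rightarrow> 'a measure qus" where
  "P_space X =
     ({push X \<alpha> P | \<alpha> P. \<alpha> \<in> rvs X \<and> P \<in> qcarrier (G_space omega_qus)},
      {(\<lambda>\<omega>. push X (F \<omega>) P) | F P. F \<in> fun_rvs X \<and> P \<in> qcarrier (G_space omega_qus)})"

definition S_space :: "'a qus \<Rightarrow> 'a measure qus" where
  "S_space X =
     ({push X \<alpha> P | \<alpha> P. \<alpha> \<in> rvs X \<and> P \<in> qcarrier (G_space omega_qus)},
      {(\<lambda>\<omega>. push X \<alpha> (push omega_qus (\<phi> \<omega>) P)) | \<alpha> \<phi> P.
         \<alpha> \<in> rvs X \<and> \<phi> \<in> fun_rvs omega_qus \<and> P \<in> qcarrier (G_space omega_qus)})"

end

(* Every kernel into a standard space factors through kernels on the sample space Omega, so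
   everything reduces to two facts about Omega.

   Sections: if D is a universally measurable subset of Omega x Omega and kappa is a kernel, then for
   each Borel probability lambda the set D lies between two Borel sets that differ by a null set of the
   semidirect product of lambda and kappa; by Fubini w |-> kappa(w)(D_w) agrees lambda-almost
   everywhere with a measurable function.  This gives K <= G and G = Q.

   Randomization: Omega is a Borel retract of the real line, so a probability measure on Omega is
   determined by the values of a distribution function at the rationals, which is again a point of
   Omega, and it is recovered from this point by feeding uniform noise into the quantile function.
   The quantile function is an infimum over rationals of jointly measurable functions, defined for
   every point of Omega.  This gives G <= S and at the same time exhibits G(Omega) as a retract of
   Omega. *)

theory Submission
  imports Defs
begin

section \<open>Universally measurable sets\<close>

text \<open>The distribution of \<open>f\<close> is a probability measure on the sets of
  \<open>N\<close>, so its completion contains every universally measurable set. Null sets of this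
  distribution pull back to null sets, hence so do their subsets in the complete source.\<close>

lemma measurable_completion_univ_measurable:
  assumes M: "prob_space M" and f: "f \<in> completion M \<rightarrow>\<^sub>M N"
  shows "f \<in> completion M \<rightarrow>\<^sub>M univ_measurable N"
proof (rule measurableI)
  show "f x \<in> space (univ_measurable N)" if "x \<in> space (completion M)" for x
    using measurable_space[OF f that] by simp
next
  fix A assume A: "A \<in> sets (univ_measurable N)"
  let ?\<nu> = "distr (completion M) N f"
  have "prob_space ?\<nu>"
    using f by (intro prob_space.prob_space_distr prob_space.prob_space_completion M)
  then have "A \<in> sets (completion ?\<nu>)"
    using A by (auto simp: sets_univ_measurable)
  moreover have "f \<in> completion M \<rightarrow>\<^sub>M completion ?\<nu>"
    using f distr_cong[of "completion M" "completion M" N ?\<nu> f f]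
    by (intro completion.measurable_completion2) simp_all
  ultimately show "f -` A \<inter> space (completion M) \<in> sets (completion M)"
    by (rule measurable_sets[rotated])
qed

lemma sets_univ_measurable_superset: "sets M \<subseteq> sets (univ_measurable M)"
  using sets.sets_into_space by (auto simp: sets_univ_measurable)

lemma measurable_univ_measurableD:
  assumes "f \<in> univ_measurable M \<rightarrow>\<^sub>M N" "prob_space \<mu>" "sets \<mu> = sets M"
  shows "f \<in> completion \<mu> \<rightarrow>\<^sub>M N"
proof -
  have "space \<mu> = space M"
    by (rule sets_eq_imp_space_eq) fact
  then show ?thesis
    using assms by (auto simp: measurable_def sets_univ_measurable)
qed

lemma measurable_univ_measurable_iff:
  "f \<in> univ_measurable M \<rightarrow>\<^sub>M N \<longleftrightarrow> f \<in> space M \<rightarrow> space N \<and>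
     (\<forall>\<mu>. prob_space \<mu> \<and> sets \<mu> = sets M \<longrightarrow> f \<in> completion \<mu> \<rightarrow>\<^sub>M N)" (is "_ \<longleftrightarrow> ?r")
proof
  assume f: "f \<in> univ_measurable M \<rightarrow>\<^sub>M N"
  show ?r
    using measurable_univ_measurableD[OF f] measurable_space[OF f] by simp
next
  assume r: ?r
  show "f \<in> univ_measurable M \<rightarrow>\<^sub>M N"
  proof (rule measurableI)
    fix A assume A: "A \<in> sets N"
    have "f -` A \<inter> space M \<in> sets (completion \<mu>)"
      if "prob_space \<mu>" "sets \<mu> = sets M" for \<mu>
      using measurable_sets[of f "completion \<mu>" N A] r that A sets_eq_imp_space_eq[OF that(2)]
      by simp
    then show "f -` A \<inter> space (univ_measurable M) \<in> sets (univ_measurable M)"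
      by (auto simp: sets_univ_measurable)
  qed (use r in auto)
qed

text \<open>Both sides can be tested on one completion at a time, where the previous upgrade of the
  target applies. Later proofs therefore check Borel preimages only, and obtain closure of such maps
  under composition.\<close>

lemma measurable_univ_measurable_cod:
  assumes "f \<in> univ_measurable M \<rightarrow>\<^sub>M N"
  shows "f \<in> univ_measurable M \<rightarrow>\<^sub>M univ_measurable N"
  using assms measurable_completion_univ_measurable[of _ f N]
  unfolding measurable_univ_measurable_iff[of f M] by simp

lemma measurable_univ_measurable_dom:
  assumes "f \<in> M \<rightarrow>\<^sub>M N"
  shows "f \<in> univ_measurable M \<rightarrow>\<^sub>M N"
  using assms sets_univ_measurable_superset[of M] unfolding measurable_def by auto

lemma measurable_univ_measurable_weaken:
  assumes "f \<in> L \<rightarrow>\<^sub>M univ_measurable N"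
  shows "f \<in> L \<rightarrow>\<^sub>M N"
  using assms sets_univ_measurable_superset[of N] by (auto simp: measurable_def)

text \<open>The trace of \<mu> on \<open>M\<close> squeezes \<open>A\<close> between
  \<open>S\<close> and \<open>S \<union> N'\<close>, both in \<open>M\<close>. Agreement on
  \<open>M\<close> makes \<open>N'\<close> null for \<nu> as well, so one pair of bounds computes
  both values at \<open>A\<close>.\<close>

lemma prob_space_univ_measurable_eqI:
  assumes \<mu>: "prob_space \<mu>" "sets \<mu> = sets (univ_measurable M)"
    and \<nu>: "prob_space \<nu>" "sets \<nu> = sets (univ_measurable M)"
    and eq: "\<And>A. A \<in> sets M \<Longrightarrow> emeasure \<mu> A = emeasure \<nu> A"
  shows "\<mu> = \<nu>"
proof (rule measure_eqI)
  show "sets \<mu> = sets \<nu>" using \<mu> \<nu> by simp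
  fix A assume A: "A \<in> sets \<mu>"
  have id: "(\<lambda>x. x) \<in> \<mu> \<rightarrow>\<^sub>M M"
    using \<mu>(2) by (blast intro: measurable_univ_measurable_weaken[OF measurable_ident_sets])
  let ?\<mu> = "distr \<mu> M (\<lambda>x. x)"
  have "A \<in> sets (completion ?\<mu>)"
    using A \<mu>(2) prob_space.prob_space_distr[OF \<mu>(1) id] by (simp add: sets_univ_measurable)
  then obtain S N N' where S: "A = S \<union> N" "N \<subseteq> N'" "N' \<in> null_sets ?\<mu>" "S \<in> sets ?\<mu>"
    by (rule sets_completionE)
  have M: "S \<in> sets M" "N' \<in> sets M" "S \<union> N' \<in> sets M"
    using S by auto
  have sub: "B \<in> sets \<mu>" "B \<in> sets \<nu>" if "B \<in> sets M" for B
    using that sets_univ_measurable_superset[of M] \<mu>(2) \<nu>(2) by auto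
  have "emeasure ?\<mu> N' = 0"
    using S by auto
  then have N': "emeasure \<mu> N' = 0"
    using M(2) id sub(1)[OF M(2)] sets.sets_into_space[OF sub(1)[OF M(2)]]
    by (simp add: emeasure_distr Int_absorb2)
  have "emeasure \<rho> A = emeasure \<rho> S"
    if "\<rho> = \<mu> \<or> \<rho> = \<nu>" for \<rho>
  proof (rule antisym)
    have \<rho>: "A \<in> sets \<rho>" "S \<in> sets \<rho>" "N' \<in> sets \<rho>" "emeasure \<rho> N' = 0"
      using that A \<mu>(2) \<nu>(2) sub M N' eq[OF M(2)] by auto
    show "emeasure \<rho> A \<le> emeasure \<rho> S"
    proof -
      have "emeasure \<rho> A \<le> emeasure \<rho> (S \<union> N')"
        using \<rho> S by (intro emeasure_mono) auto
      also have "\<dots> \<le> emeasure \<rho> S"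
        using emeasure_subadditive[of S \<rho> N'] \<rho> by simp
      finally show ?thesis .
    qed
    show "emeasure \<rho> S \<le> emeasure \<rho> A"
      using \<rho> S by (intro emeasure_mono) auto
  qed
  then show "emeasure \<mu> A = emeasure \<nu> A"
    using eq[OF M(1)] by metis
qed

text \<open>Preimages under \<open>f\<close> and \<open>g\<close> differ by a subset of a null set,
  and completeness makes such sets measurable.\<close>

lemma (in complete_measure) measurable_AE_eq:
  assumes "AE x in M. f x = g x" "g \<in> M \<rightarrow>\<^sub>M N" "f \<in> space M \<rightarrow> space N"
  shows "f \<in> M \<rightarrow>\<^sub>M N"
proof (rule measurableI)
  fix A assume "A \<in> sets N"
  then have m: "g -` A \<inter> space M \<in> sets M"
    using assms by (intro measurable_sets)
  have ae: "AE x in M. x \<in> g -` A \<inter> space M \<longleftrightarrow> x \<in> f -` A \<inter> space M"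
    using assms(1) by eventually_elim auto
  show "f -` A \<inter> space M \<in> sets M"
    by (rule in_sets_AE[OF ae m]) auto
qed (use assms in auto)

text \<open>On the completion of each \<mu> it suffices to agree almost everywhere with the section
  function of a set in \<open>M \<Otimes>\<^sub>M N\<close>, for which measurability is standard.
  That set may depend on \<mu>.\<close>

lemma measurable_kernel_section:
  assumes prob: "\<And>x. x \<in> space M \<Longrightarrow> prob_space (\<kappa> x)"
    and sets: "\<And>x. x \<in> space M \<Longrightarrow> sets (\<kappa> x) = sets (univ_measurable N)"
    and meas: "\<And>A. A \<in> sets N \<Longrightarrow> (\<lambda>x. measure (\<kappa> x) A) \<in> borel_measurable (univ_measurable M)"
    and D: "D \<in> sets (univ_measurable (M \<Otimes>\<^sub>M N))"
  shows "(\<lambda>x. measure (\<kappa> x) (Pair x -` D)) \<in> borel_measurable (univ_measurable M)"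
  unfolding measurable_univ_measurable_iff
proof (intro conjI allI impI; (elim conjE)?)
  fix \<mu> assume \<mu>: "prob_space \<mu>" "sets \<mu> = sets M"
  have sp: "space \<mu> = space M"
    by (rule sets_eq_imp_space_eq) fact
  have id: "(\<lambda>y. y) \<in> \<kappa> x \<rightarrow>\<^sub>M N" if "x \<in> space M" for x
    using sets[OF that] by (blast intro: measurable_univ_measurable_weaken[OF measurable_ident_sets])
  \<comment> \<open>Since \<open>meas\<close> speaks about sets of \<open>N\<close> only, the kernel
    is first cut down to \<open>N\<close>. There it is a measurable map into
    \<open>prob_algebra N\<close>, with \<open>completion \<mu>\<close> as source because
    \<open>meas\<close> gives universal measurability.\<close>
  define \<kappa>0 where "\<kappa>0 x = distr (\<kappa> x) N (\<lambda>y. y)" for x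
  have \<kappa>0_eq: "measure (\<kappa>0 x) A = measure (\<kappa> x) A" if "x \<in> space M" "A \<in> sets N" for x A
    using that id[OF that(1)] sets_eq_imp_space_eq[OF sets[OF that(1)]] sets.sets_into_space[OF that(2)]
    by (simp add: \<kappa>0_def measure_distr Int_absorb2)
  have \<kappa>0_prob: "prob_space (\<kappa>0 x)" if "x \<in> space M" for x
    unfolding \<kappa>0_def using prob id that by (intro prob_space.prob_space_distr)
  have [measurable]: "\<kappa>0 \<in> completion \<mu> \<rightarrow>\<^sub>M prob_algebra N"
  proof (rule measurable_prob_algebraI)
    show "\<kappa>0 \<in> completion \<mu> \<rightarrow>\<^sub>M subprob_algebra N"
    proof (rule measurable_subprob_algebra)
      fix A assume A: "A \<in> sets N"
      have "(\<lambda>x. ennreal (measure (\<kappa> x) A)) \<in> borel_measurable (completion \<mu>)"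
        using measurable_univ_measurableD[OF meas[OF A] \<mu>] by measurable
      moreover have "emeasure (\<kappa>0 x) A = ennreal (measure (\<kappa> x) A)" if x: "x \<in> space M" for x
      proof -
        interpret prob_space "\<kappa>0 x" by (rule \<kappa>0_prob[OF x])
        show ?thesis
          using \<kappa>0_eq[OF x A] by (simp add: emeasure_eq_measure)
      qed
      ultimately show "(\<lambda>x. emeasure (\<kappa>0 x) A) \<in> borel_measurable (completion \<mu>)"
        by (subst measurable_cong[where g = "\<lambda>x. ennreal (measure (\<kappa> x) A)"]) (use sp in simp_all)
    qed (use sp \<kappa>0_prob in \<open>auto simp: prob_space_imp_subprob_space \<kappa>0_def\<close>)
  qed (use sp \<kappa>0_prob in auto)
  have comp: "completion \<mu> \<in> space (prob_algebra (completion \<mu>))"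
    using prob_space.prob_space_completion[OF \<mu>(1)] by (simp add: space_prob_algebra)
  have idM: "(\<lambda>x. x) \<in> completion \<mu> \<rightarrow>\<^sub>M M"
    using \<mu>(2) sp by (intro measurable_completion measurable_ident_sets) auto
  have pm: "(\<lambda>(x, y). (x, y)) \<in> completion \<mu> \<Otimes>\<^sub>M N \<rightarrow>\<^sub>M M \<Otimes>\<^sub>M N"
    using measurable_compose[OF measurable_fst[of "completion \<mu>" N] idM] by measurable
  \<comment> \<open>\<open>\<beta> x\<close> is the product of the point mass at \<open>x\<close>
    with \<open>\<kappa>0 x\<close>; binding it to \<open>completion \<mu>\<close> yields the
    semidirect product, whose sets are those of \<open>M \<Otimes>\<^sub>M N\<close>, so that
    \<open>D\<close> lies in its completion.\<close>
  define \<beta> where "\<beta> x = distr (\<kappa>0 x) (M \<Otimes>\<^sub>M N) (Pair x)" for x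
  have \<beta>: "\<beta> \<in> completion \<mu> \<rightarrow>\<^sub>M prob_algebra (M \<Otimes>\<^sub>M N)"
    unfolding \<beta>_def using pm by (intro measurable_distr_prob_space2) auto
  have \<beta>_eq: "emeasure (\<beta> x) B = emeasure (\<kappa>0 x) (Pair x -` B)"
    if x: "x \<in> space M" and B: "B \<in> sets (M \<Otimes>\<^sub>M N)" for x B
  proof -
    have "Pair x -` B \<inter> space N = Pair x -` B"
      using sets.sets_into_space[OF B] by (auto simp: space_pair_measure)
    then show ?thesis
      using x B by (simp add: \<beta>_def \<kappa>0_def emeasure_distr)
  qed
  define \<pi> where "\<pi> = completion \<mu> \<bind> \<beta>"
  have \<pi>: "prob_space \<pi>" "sets \<pi> = sets (M \<Otimes>\<^sub>M N)"
    unfolding \<pi>_def using prob_space_bind'[OF comp \<beta>] sets_bind'[OF comp \<beta>] by auto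
  have "D \<in> sets (completion \<pi>)"
    using D \<pi> by (auto simp: sets_univ_measurable)
  then obtain S Z Z' where S: "D = S \<union> Z" "Z \<subseteq> Z'" "Z' \<in> null_sets \<pi>" "S \<in> sets \<pi>"
    by (rule sets_completionE)
  have SZ: "S \<in> sets (M \<Otimes>\<^sub>M N)" "Z' \<in> sets (M \<Otimes>\<^sub>M N)"
    using S \<pi> by auto
  have sub: "B \<in> sets (\<kappa> x)" if "x \<in> space M" "B \<in> sets N" for x B
    using that(2) sets[OF that(1)] sets_univ_measurable_superset[of N] by auto
  have "(\<integral>\<^sup>+x. emeasure (\<beta> x) Z' \<partial>completion \<mu>) = emeasure \<pi> Z'"
    unfolding \<pi>_def by (rule emeasure_bind_prob_algebra[OF comp \<beta> SZ(2), symmetric])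
  also have "\<dots> = 0" using S by auto
  finally have AE0: "AE x in completion \<mu>. emeasure (\<beta> x) Z' = 0"
    using measurable_compose[OF measurable_prob_algebraD[OF \<beta>] measurable_emeasure_subprob_algebra[OF SZ(2)]]
    by (subst (asm) nn_integral_0_iff_AE)
  \<comment> \<open>Sections of \<open>D\<close> are known to be universally measurable, so they are
    compared in \<open>\<kappa> x\<close> rather than in \<open>\<kappa>0 x\<close>: the section of
    \<open>D\<close> contains that of \<open>S\<close> and exceeds it by at most the null section of
    \<open>Z'\<close>.\<close>
  have sec_eq: "measure (\<kappa> x) (Pair x -` D) = measure (\<kappa>0 x) (Pair x -` S)"
    if x: "x \<in> space M" and null: "emeasure (\<beta> x) Z' = 0" for x
  proof -
    interpret prob_space "\<kappa> x" by (rule prob[OF x])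
    note sec = sets_Pair1[OF SZ(1), of x] sets_Pair1[OF SZ(2), of x]
    have "Pair x \<in> univ_measurable N \<rightarrow>\<^sub>M univ_measurable (M \<Otimes>\<^sub>M N)"
      using x by (intro measurable_univ_measurable_cod measurable_univ_measurable_dom measurable_Pair1')
    from measurable_sets[OF this D] have "Pair x -` D \<inter> space N \<in> sets (univ_measurable N)"
      by simp
    moreover have "D \<subseteq> space M \<times> space N"
      using sets.sets_into_space[OF D] by (simp add: space_pair_measure)
    then have "Pair x -` D \<inter> space N = Pair x -` D" by auto
    ultimately have D': "Pair x -` D \<in> sets (\<kappa> x)"
      using sets[OF x] by simp
    have "measure (\<kappa>0 x) (Pair x -` Z') = 0"
      using null \<beta>_eq[OF x SZ(2)] by (simp add: measure_def)
    then have 0: "prob (Pair x -` Z') = 0"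
      using \<kappa>0_eq[OF x sec(2)] by simp
    have "prob (Pair x -` D) \<le> prob (Pair x -` S \<union> Pair x -` Z')"
      using S sub[OF x sec(1)] sub[OF x sec(2)] by (intro finite_measure_mono) auto
    also have "\<dots> \<le> prob (Pair x -` S)"
      using measure_Un_le[OF sub[OF x sec(1)] sub[OF x sec(2)]] 0 by simp
    finally have "prob (Pair x -` D) \<le> prob (Pair x -` S)" .
    moreover have "prob (Pair x -` S) \<le> prob (Pair x -` D)"
      using S D' by (intro finite_measure_mono) auto
    ultimately show ?thesis
      using \<kappa>0_eq[OF x sec(1)] by simp
  qed
  have "AE x in completion \<mu>.
      measure (\<kappa> x) (Pair x -` D) = measure (\<kappa>0 x) (Pair x -` S)"
    using AE0 AE_space[of "completion \<mu>"] by eventually_elim (rule sec_eq, use sp in simp_all)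
  moreover have "(\<lambda>x. measure (\<kappa>0 x) (Pair x -` S)) \<in> borel_measurable (completion \<mu>)"
  proof (rule measure_measurable_prob_algebra2)
    have "(SIGMA x:space (completion \<mu>). Pair x -` S) = (\<lambda>(x, y). (x, y)) -` S \<inter> space (completion \<mu> \<Otimes>\<^sub>M N)"
      using sp sets.sets_into_space[OF SZ(1)] by (auto simp: space_pair_measure)
    then show "(SIGMA x:space (completion \<mu>). Pair x -` S) \<in> sets (completion \<mu> \<Otimes>\<^sub>M N)"
      using measurable_sets[OF pm SZ(1)] by simp
  qed measurable
  ultimately show "(\<lambda>x. measure (\<kappa> x) (Pair x -` D)) \<in> borel_measurable (completion \<mu>)"
    by (rule completion.measurable_AE_eq) simp
qed simp

section \<open>Coding and randomization on the Hilbert cube\<close>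

text \<open>Clamping to the unit interval turns every real sequence into a point, so maps into
  \<open>omega\<close> can be built coordinatewise with no range conditions.\<close>

definition mk_omega :: "(nat \<Rightarrow> real) \<Rightarrow> omega" where
  "mk_omega f = Abs_omega (\<lambda>n. max 0 (min 1 (f n)))"

lemma Rep_mk_omega: "Rep_omega (mk_omega f) n = max 0 (min 1 (f n))"
  unfolding mk_omega_def by (subst Abs_omega_inverse) auto

lemma mk_omega_Rep: "mk_omega (Rep_omega w) = w"
proof -
  have "(\<lambda>n. max 0 (min 1 (Rep_omega w n))) = Rep_omega w"
    using Rep_omega[of w] by (fastforce simp: fun_eq_iff)
  then show ?thesis
    by (simp add: mk_omega_def Rep_omega_inverse)
qed

lemma measurable_Rep_omega: "(\<lambda>w. Rep_omega w n) \<in> borel_measurable borel_omega"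
  unfolding borel_omega_def
  by (rule measurable_product_then_coordinatewise, rule measurable_vimage_algebra1) simp

lemma measurable_mk_omega:
  assumes "\<And>n. (\<lambda>x. f x n) \<in> borel_measurable M"
  shows "(\<lambda>x. mk_omega (f x)) \<in> M \<rightarrow>\<^sub>M borel_omega"
  unfolding borel_omega_def
proof (rule measurable_vimage_algebra2)
  show "(\<lambda>x. Rep_omega (mk_omega (f x))) \<in> borel_measurable M"
    using assms by (intro measurable_coordinatewise_then_product) (simp add: Rep_mk_omega)
qed simp

section \<open>Rational cuts and ternary digits: the Hilbert cube as a Borel retract of the real
  line\<close>

definition rat_enum :: "nat \<Rightarrow> real" where
  "rat_enum n = real_of_rat (from_nat n)"

lemma rat_enum_between:
  assumes "a < b" obtains n where "a < rat_enum n" "rat_enum n < b"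
proof -
  obtain q where "a < real_of_rat q" "real_of_rat q < b"
    using of_rat_dense[OF assms] by auto
  then show ?thesis
    using that[of "to_nat q"] by (simp add: rat_enum_def)
qed

text \<open>Taken in the extended reals, so that the countable infimum is measurable without any
  boundedness or nonemptiness assumption on \<open>b\<close>.\<close>

definition rat_inf :: "(nat \<Rightarrow> bool) \<Rightarrow> real" where
  "rat_inf b = real_of_ereal (INF n. if b n then ereal (rat_enum n) else \<infinity>)"

text \<open>Density of the rationals. This inverts the passage from a real to its upper rational
  cut, both for decoding points and for recovering quantiles.\<close>

lemma rat_inf_cut: "rat_inf (\<lambda>n. x \<le> rat_enum n) = x"
proof -
  have "(INF n. if x \<le> rat_enum n then ereal (rat_enum n) else \<infinity>) = ereal x"
  proof (rule antisym)
    show "ereal x \<le> (INF n. if x \<le> rat_enum n then ereal (rat_enum n) else \<infinity>)"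
      by (rule INF_greatest) simp
    show "(INF n. if x \<le> rat_enum n then ereal (rat_enum n) else \<infinity>) \<le> ereal x"
    proof (rule dense_ge)
      fix z assume "ereal x < z"
      then obtain y where y: "x < y" "ereal y < z"
        using ereal_dense2 by (metis less_ereal.simps(1))
      obtain n where n: "x < rat_enum n" "rat_enum n < y"
        using rat_enum_between[OF y(1)] .
      have "(INF n. if x \<le> rat_enum n then ereal (rat_enum n) else \<infinity>) \<le> ereal (rat_enum n)"
        by (rule INF_lower2[of n]) (use n in auto)
      also have "\<dots> \<le> z"
        using n y(2) by (meson less_ereal.simps(1) less_le_trans less_imp_le order.trans)
      finally show "(INF n. if x \<le> rat_enum n then ereal (rat_enum n) else \<infinity>) \<le> z" .
    qed
  qed
  then show ?thesis by (simp add: rat_inf_def)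
qed

lemma measurable_rat_inf:
  assumes [measurable]: "\<And>n. Measurable.pred M (\<lambda>x. b x n)"
  shows "(\<lambda>x. rat_inf (b x)) \<in> borel_measurable M"
  unfolding rat_inf_def by measurable

text \<open>Only the digits 0 and 1 occur, so the values form the Cantor set scaled by 1/2. Base 3
  avoids the double expansions of base 2: every tail is at most 1/2 of a unit in the last place, so
  no carry can arise.\<close>

definition ternary :: "(nat \<Rightarrow> bool) \<Rightarrow> real" where
  "ternary b = (\<Sum>k. of_bool (b k) / 3 ^ Suc k)"

definition digit :: "nat \<Rightarrow> real \<Rightarrow> bool" where
  "digit k x \<longleftrightarrow> \<lfloor>3 ^ Suc k * x\<rfloor> mod 3 = 1"

lemma half_sums: "(\<lambda>k. 1 / 3 ^ Suc k) sums (1 / 2 :: real)"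
  using sums_mult[OF geometric_sums[of "1 / 3 :: real"], of "1 / 3"]
  by (simp add: power_one_over field_simps)

lemma summable_ternary: "summable (\<lambda>k. of_bool (b k) / 3 ^ Suc k :: real)"
  by (rule summable_comparison_test'[OF sums_summable[OF half_sums], of 0]) auto

lemma ternary_bounds: "0 \<le> ternary b" "ternary b \<le> 1 / 2"
proof -
  show "0 \<le> ternary b"
    unfolding ternary_def by (intro suminf_nonneg summable_ternary) auto
  show "ternary b \<le> 1 / 2"
    unfolding ternary_def sums_unique[OF half_sums]
    by (intro suminf_le summable_ternary sums_summable[OF half_sums]) auto
qed

text \<open>Multiplying by \<open>3 ^ Suc k\<close> moves the first \<open>Suc k\<close> digits in
  front of the point, where they form the integer \<open>N\<close>. The rest lies between 0 and 1/2
  and leaves the floor unchanged.\<close>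

lemma digit_ternary: "digit k (ternary b) \<longleftrightarrow> b k"
proof -
  \<comment> \<open>One factor 3 is taken out of the sum, which lowers the exponent from
    \<open>k - j\<close> to \<open>k - Suc j\<close> and exhibits \<open>b k\<close> as the residue
    modulo 3.\<close>
  define N :: int where "N = 3 * (\<Sum>j<k. of_bool (b j) * 3 ^ (k - Suc j)) + of_bool (b k)"
  have tail: "(\<Sum>j. of_bool (b (j + Suc k)) / 3 ^ Suc (j + Suc k)) = ternary (\<lambda>j. b (j + Suc k)) / 3 ^ Suc k"
    unfolding ternary_def
    by (subst suminf_divide[OF summable_ternary, symmetric])
      (simp add: power_add mult_ac)
  have "ternary b = ternary (\<lambda>j. b (j + Suc k)) / 3 ^ Suc k + (\<Sum>j<Suc k. of_bool (b j) / 3 ^ Suc j)"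
    unfolding tail[symmetric] unfolding ternary_def
    by (rule suminf_split_initial_segment[OF summable_ternary])
  then have "3 ^ Suc k * ternary b = ternary (\<lambda>j. b (j + Suc k)) + (\<Sum>j<Suc k. 3 ^ Suc k * (of_bool (b j) / 3 ^ Suc j))"
    by (simp only: distrib_left sum_distrib_left) simp
  also have "(\<Sum>j<Suc k. 3 ^ Suc k * (of_bool (b j) / 3 ^ Suc j) :: real) =
      (\<Sum>j<k. 3 * (of_bool (b j) * 3 ^ (k - Suc j))) + of_bool (b k)"
  proof -
    have "(3::real) ^ Suc k = 3 * 3 ^ (k - Suc j) * 3 ^ Suc j" if "j < k" for j
      using that by (simp flip: power_add power_Suc)
    then show ?thesis by (simp add: mult_ac)
  qed
  also have "\<dots> = of_int N"
    by (simp add: N_def sum_distrib_left del: sum_mult_of_bool_eq sum_of_bool_mult_eq)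
  finally have "\<lfloor>3 ^ Suc k * ternary b\<rfloor> = N"
    using ternary_bounds[of "\<lambda>j. b (j + Suc k)"] by (intro floor_unique) auto
  then show ?thesis
    unfolding digit_def by (simp add: N_def)
qed

lemma measurable_digit:
  assumes [measurable]: "f \<in> borel_measurable M"
  shows "Measurable.pred M (\<lambda>x. digit k (f x))"
  unfolding digit_def by measurable

text \<open>Each coordinate becomes its upper rational cut, and pairing of indices merges all these
  bits into one sequence. The bits are Borel functions of the point, hence so is the code.\<close>

definition code :: "omega \<Rightarrow> real" where
  "code w = ternary (\<lambda>k. case prod_decode k of (m, n) \<Rightarrow> Rep_omega w m \<le> rat_enum n)"

definition decode :: "real \<Rightarrow> omega" where
  "decode x = mk_omega (\<lambda>m. rat_inf (\<lambda>n. digit (prod_encode (m, n)) x))"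

lemma decode_code: "decode (code w) = w"
  by (simp add: decode_def code_def digit_ternary rat_inf_cut mk_omega_Rep)

lemma measurable_code: "code \<in> borel_measurable borel_omega"
proof -
  note measurable_Rep_omega[measurable]
  have "(\<lambda>w. of_bool (case prod_decode k of (m, n) \<Rightarrow> Rep_omega w m \<le> rat_enum n) / 3 ^ Suc k :: real)
      \<in> borel_measurable borel_omega" for k
    by (cases "prod_decode k") simp
  then show ?thesis
    unfolding code_def ternary_def by (intro borel_measurable_suminf)
qed

lemma measurable_decode: "decode \<in> borel \<rightarrow>\<^sub>M borel_omega"
  unfolding decode_def by (intro measurable_mk_omega measurable_rat_inf measurable_digit) simp

section \<open>Randomization: measures on the cube from distribution functions and uniform
  noise\<close>

definition cdf_code :: "omega measure \<Rightarrow> omega" where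
  "cdf_code \<mu> = mk_omega (\<lambda>n. measure \<mu> {w. code w \<le> rat_enum n})"

text \<open>Uniform noise, spread over constant sequences. The completion makes the map measurable
  for all universally measurable sets; the interval is open because the quantile function is used
  only strictly between 0 and 1.\<close>

definition noise :: "omega measure" where
  "noise = distr (completion (restrict_space lborel {0<..<1})) B_omega (\<lambda>u. mk_omega (\<lambda>_. u))"

text \<open>Coordinate \<open>n\<close> of \<open>w\<close> is read as the value of a distribution
  function at \<open>rat_enum n\<close>; the argument of \<open>decode\<close> is then its quantile
  at level \<open>Rep_omega u 0\<close>. The formula makes sense for arbitrary \<open>w\<close>,
  which keeps it jointly Borel on the whole cube.\<close>

definition randomizer :: "omega \<Rightarrow> omega \<Rightarrow> omega" where
  "randomizer w u = decode (rat_inf (\<lambda>n. Rep_omega u 0 \<le> Rep_omega w n))"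

lemma measurable_randomizer:
  assumes "\<alpha> \<in> M \<rightarrow>\<^sub>M borel_omega" "\<beta> \<in> M \<rightarrow>\<^sub>M borel_omega"
  shows "(\<lambda>x. randomizer (\<alpha> x) (\<beta> x)) \<in> M \<rightarrow>\<^sub>M borel_omega"
proof -
  have [measurable]: "(\<lambda>x. Rep_omega (\<alpha> x) n) \<in> borel_measurable M"
    "(\<lambda>x. Rep_omega (\<beta> x) n) \<in> borel_measurable M" for n
    using assms by (auto intro: measurable_compose measurable_Rep_omega)
  show ?thesis
    unfolding randomizer_def
    by (rule measurable_compose[OF measurable_rat_inf measurable_decode]) measurable
qed

lemma prob_space_uniform: "prob_space (restrict_space lborel {0<..<1::real})"
  by (auto simp: emeasure_restrict_space space_restrict_space intro!: prob_spaceI)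

lemma measurable_const_omega: "(\<lambda>u. mk_omega (\<lambda>_. u)) \<in> restrict_space lborel {0<..<1} \<rightarrow>\<^sub>M borel_omega"
  by (intro measurable_mk_omega measurable_restrict_space1) simp

lemma measurable_const_omega_completion:
  "(\<lambda>u. mk_omega (\<lambda>_. u)) \<in> completion (restrict_space lborel {0<..<1}) \<rightarrow>\<^sub>M B_omega"
  by (intro measurable_completion_univ_measurable prob_space_uniform measurable_completion
      measurable_const_omega)

lemma prob_space_noise: "prob_space noise"
  unfolding noise_def
  by (intro prob_space.prob_space_distr prob_space.prob_space_completion prob_space_uniform
      measurable_const_omega_completion)

lemma sets_noise: "sets noise = sets B_omega"
  by (simp add: noise_def)

lemma measurable_randomizer_univ: "randomizer w \<in> B_omega \<rightarrow>\<^sub>M B_omega"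
  by (rule measurable_univ_measurable_cod, rule measurable_univ_measurable_dom,
      rule measurable_randomizer[OF measurable_const measurable_ident[unfolded id_def]]) simp

text \<open>Inverse transform sampling: the quantile function of the image of \<mu> under
  \<open>code\<close> carries uniform noise to that image, and \<open>decode\<close> carries the
  image back to \<mu>. Equality is checked on Borel sets.\<close>

lemma distr_noise_randomizer:
  assumes \<mu>: "prob_space \<mu>" "sets \<mu> = sets B_omega"
  shows "distr noise B_omega (randomizer (cdf_code \<mu>)) = \<mu>"
proof (rule prob_space_univ_measurable_eqI[OF _ _ \<mu>])
  let ?U = "restrict_space lborel {0<..<1::real}" and ?r = "randomizer (cdf_code \<mu>)"
  note r = measurable_randomizer_univ[of "cdf_code \<mu>"]
  have rn: "?r \<in> noise \<rightarrow>\<^sub>M B_omega"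
    using r by (simp add: measurable_cong_sets[OF sets_noise refl])
  have [measurable]: "code \<in> \<mu> \<rightarrow>\<^sub>M borel"
    using measurable_univ_measurable_dom[OF measurable_code] by (simp add: measurable_cong_sets[OF \<mu>(2) refl])
  have [measurable]: "(\<lambda>w. w) \<in> \<mu> \<rightarrow>\<^sub>M borel_omega"
    using \<mu>(2) by (blast intro: measurable_univ_measurable_weaken[OF measurable_ident_sets])
  have sp: "space \<mu> = UNIV"
    using sets_eq_imp_space_eq[OF \<mu>(2)] by simp
  interpret prob_space \<mu> by fact
  let ?L = "distr \<mu> borel code"
  interpret L: cdf_distribution ?L
    unfolding cdf_distribution_def by (rule real_distribution_distr) measurable
  \<comment> \<open>Values of a distribution function lie in the unit interval, so clamping does not
    change them.\<close>
  have C: "Rep_omega (cdf_code \<mu>) n = L.C (rat_enum n)" for n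
    using L.cdf_bounded_prob[of "rat_enum n"] L.cdf_nonneg[of "rat_enum n"]
    by (simp add: cdf_code_def Rep_mk_omega cdf_def measure_distr sp vimage_def)
  \<comment> \<open>The Galois connection between the distribution function and its pseudoinverse
    turns the condition on levels into the rational cut of \<open>L.I u\<close>.\<close>
  have eq: "?r (mk_omega (\<lambda>_. u)) = decode (L.I u)" if "u \<in> {0<..<1}" for u
  proof -
    have "(\<lambda>n. u \<le> L.C (rat_enum n)) = (\<lambda>n. L.I u \<le> rat_enum n)"
      by (rule ext) (rule spec[OF bspec[OF L.pseudoinverse' that]])
    then have "rat_inf (\<lambda>n. u \<le> L.C (rat_enum n)) = L.I u"
      by (rule ssubst[where P = "\<lambda>b. rat_inf b = L.I u"]) (rule rat_inf_cut)
    then show ?thesis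
      using that by (simp add: randomizer_def C Rep_mk_omega)
  qed
  show "prob_space (distr noise B_omega ?r)"
    by (intro prob_space.prob_space_distr prob_space_noise rn)
  show "sets (distr noise B_omega ?r) = sets B_omega" by simp
  have ro: "?r \<in> B_omega \<rightarrow>\<^sub>M borel_omega"
    by (rule measurable_univ_measurable_weaken[OF r])
  have "distr noise borel_omega ?r = distr (completion ?U) borel_omega (?r \<circ> (\<lambda>u. mk_omega (\<lambda>_. u)))"
    unfolding noise_def by (rule distr_distr[OF ro measurable_const_omega_completion])
  also have "\<dots> = distr ?U borel_omega (?r \<circ> (\<lambda>u. mk_omega (\<lambda>_. u)))"
  proof (rule distr_completion)
    have "?r \<in> borel_omega \<rightarrow>\<^sub>M borel_omega"
      by (rule measurable_randomizer[OF measurable_const measurable_ident[unfolded id_def]]) simp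
    then show "?r \<circ> (\<lambda>u. mk_omega (\<lambda>_. u)) \<in> ?U \<rightarrow>\<^sub>M borel_omega"
      using measurable_const_omega by (rule measurable_comp[rotated])
  qed
  also have "\<dots> = distr ?U borel_omega (decode \<circ> L.I)"
    by (rule distr_cong) (use eq in \<open>auto simp: space_restrict_space\<close>)
  also have "\<dots> = distr (distr ?U borel L.I) borel_omega decode"
    using L.measurable_CI
    by (intro distr_distr[symmetric] measurable_decode)
      (simp add: measurable_cong_sets[OF sets_restrict_space_cong[OF sets_lborel] refl])
  also have "\<dots> = distr ?L borel_omega decode"
    by (simp only: L.distr_I_eq_M)
  also have "\<dots> = distr \<mu> borel_omega (decode \<circ> code)"
    by (intro distr_distr measurable_decode) measurable
  also have "\<dots> = distr \<mu> borel_omega (\<lambda>w. w)"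
    by (simp add: comp_def decode_code)
  finally have *: "distr noise borel_omega ?r = distr \<mu> borel_omega (\<lambda>w. w)" .
  fix A assume A: "A \<in> sets borel_omega"
  then have A': "A \<in> sets B_omega"
    using sets_univ_measurable_superset by blast
  have "emeasure (distr noise B_omega ?r) A = emeasure (distr noise borel_omega ?r) A"
    using A A' rn measurable_univ_measurable_weaken[OF rn] by (simp add: emeasure_distr)
  also have "\<dots> = emeasure \<mu> A"
    unfolding * using A by (simp add: emeasure_distr sp)
  finally show "emeasure (distr noise B_omega ?r) A = emeasure \<mu> A" .
qed

section \<open>Quasi-universal spaces of probability measures\<close>

lemma rvs_omega [simp]: "rvs omega_qus = B_omega \<rightarrow>\<^sub>M B_omega"
  by (simp only: omega_qus_def snd_conv)

lemma qcarrier_omega [simp]: "qcarrier omega_qus = UNIV"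
  by (simp only: omega_qus_def fst_conv)

lemma prod_qus_simps [simp]:
  "qcarrier (prod_qus X Y) = qcarrier X \<times> qcarrier Y"
  "\<alpha> \<in> rvs (prod_qus X Y) \<longleftrightarrow> fst \<circ> \<alpha> \<in> rvs X \<and> snd \<circ> \<alpha> \<in> rvs Y"
  by (simp_all add: prod_qus_def)

lemma quasi_universal_spaceD:
  assumes "quasi_universal_space X"
  shows rvs_in_qcarrier: "\<And>\<alpha> \<omega>. \<alpha> \<in> rvs X \<Longrightarrow> \<alpha> \<omega> \<in> qcarrier X"
    and const_in_rvs: "\<And>x. x \<in> qcarrier X \<Longrightarrow> (\<lambda>_. x) \<in> rvs X"
    and comp_in_rvs: "\<And>\<alpha> \<Phi>. \<alpha> \<in> rvs X \<Longrightarrow> \<Phi> \<in> B_omega \<rightarrow>\<^sub>M B_omega \<Longrightarrow> (\<lambda>\<omega>. \<alpha> (\<Phi> \<omega>)) \<in> rvs X"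
  using assms unfolding quasi_universal_space_def comp_def by blast+

lemma quasi_universal_prod:
  assumes X: "quasi_universal_space X" and Y: "quasi_universal_space Y"
  shows "quasi_universal_space (prod_qus X Y)"
  unfolding quasi_universal_space_def
proof (intro conjI ballI subsetI Pi_I)
  fix \<alpha> \<omega> assume "\<alpha> \<in> rvs (prod_qus X Y)"
  then show "\<alpha> \<omega> \<in> qcarrier (prod_qus X Y)"
    using rvs_in_qcarrier[OF X, of "fst \<circ> \<alpha>" \<omega>] rvs_in_qcarrier[OF Y, of "snd \<circ> \<alpha>" \<omega>]
    by (simp add: mem_Times_iff)
next
  fix z assume "z \<in> qcarrier (prod_qus X Y)"
  then show "(\<lambda>_. z) \<in> rvs (prod_qus X Y)"
    using const_in_rvs[OF X, of "fst z"] const_in_rvs[OF Y, of "snd z"]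
    by (simp add: mem_Times_iff comp_def)
next
  fix \<alpha> \<Phi> assume "\<alpha> \<in> rvs (prod_qus X Y)" "\<Phi> \<in> B_omega \<rightarrow>\<^sub>M B_omega"
  then show "\<alpha> \<circ> \<Phi> \<in> rvs (prod_qus X Y)"
    using comp_in_rvs[OF X, of "fst \<circ> \<alpha>" \<Phi>] comp_in_rvs[OF Y, of "snd \<circ> \<alpha>" \<Phi>]
    by (simp add: comp_def)
qed

lemma rvs_eq_qmeasurable:
  assumes "quasi_universal_space X"
  shows "rvs X = qmeasurable omega_qus X"
proof -
  have "\<alpha> \<in> rvs X" if "\<forall>\<beta>\<in>B_omega \<rightarrow>\<^sub>M B_omega. \<alpha> \<circ> \<beta> \<in> rvs X" for \<alpha>
    using bspec[OF that measurable_ident] by simp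
  moreover have "\<alpha> \<circ> \<beta> \<in> rvs X" if "\<alpha> \<in> rvs X" "\<beta> \<in> B_omega \<rightarrow>\<^sub>M B_omega" for \<alpha> \<beta>
    using comp_in_rvs[OF assms that] by (simp add: comp_def)
  ultimately show ?thesis
    using rvs_in_qcarrier[OF assms] unfolding qmeasurable_def rvs_omega qcarrier_omega by blast
qed

lemma measurable_induced:
  assumes X: "quasi_universal_space X" and Y: "quasi_universal_space Y"
    and g: "g \<in> qmeasurable X Y"
  shows "g \<in> induced X \<rightarrow>\<^sub>M induced Y"
proof (rule measurableI)
  fix A assume A: "A \<in> sets (induced Y)"
  have "\<alpha> -` (g -` A \<inter> qcarrier X) \<in> sets B_omega" if \<alpha>: "\<alpha> \<in> rvs X" for \<alpha>
  proof -
    have "g \<circ> \<alpha> \<in> rvs Y"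
      using g \<alpha> by (simp add: qmeasurable_def)
    then have "(g \<circ> \<alpha>) -` A \<in> sets B_omega"
      using A by (simp add: sets_induced[OF Y])
    also have "(g \<circ> \<alpha>) -` A = \<alpha> -` (g -` A \<inter> qcarrier X)"
      using rvs_in_qcarrier[OF X \<alpha>] by auto
    finally show ?thesis .
  qed
  then show "g -` A \<inter> space (induced X) \<in> sets (induced X)"
    by (simp add: sets_induced[OF X])
qed (use g in \<open>auto simp: qmeasurable_def\<close>)

lemma measurable_rv:
  assumes "quasi_universal_space X" "\<alpha> \<in> rvs X"
  shows "\<alpha> \<in> induced omega_qus \<rightarrow>\<^sub>M induced X"
  using assms rvs_eq_qmeasurable by (blast intro: measurable_induced quasi_universal_omega)

text \<open>Random variables of the product are pairs of universally measurable maps. Taking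
  \<alpha> constant and \<beta> the identity recovers that each \<open>F \<omega>\<close> is
  admissible.\<close>

lemma fun_rvs_iff:
  assumes X: "quasi_universal_space X"
  shows "F \<in> fun_rvs X \<longleftrightarrow>
    (\<forall>\<alpha>\<in>B_omega \<rightarrow>\<^sub>M B_omega. \<forall>\<beta>\<in>B_omega \<rightarrow>\<^sub>M B_omega. (\<lambda>\<omega>. F (\<alpha> \<omega>) (\<beta> \<omega>)) \<in> rvs X)"
    (is "_ \<longleftrightarrow> ?r")
proof
  assume F: "F \<in> fun_rvs X"
  show ?r
  proof (intro ballI)
    fix \<alpha> \<beta> assume "\<alpha> \<in> B_omega \<rightarrow>\<^sub>M B_omega" "\<beta> \<in> B_omega \<rightarrow>\<^sub>M B_omega"
    then have "(\<lambda>\<omega>. (\<alpha> \<omega>, \<beta> \<omega>)) \<in> rvs (prod_qus omega_qus omega_qus)"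
      by (simp add: comp_def)
    then have "(\<lambda>(\<omega>, \<omega>'). F \<omega> \<omega>') \<circ> (\<lambda>\<omega>. (\<alpha> \<omega>, \<beta> \<omega>)) \<in> rvs X"
      using F unfolding fun_rvs_def qmeasurable_def by blast
    then show "(\<lambda>\<omega>. F (\<alpha> \<omega>) (\<beta> \<omega>)) \<in> rvs X"
      by (simp add: comp_def)
  qed
next
  assume r: ?r
  have F: "F \<omega> \<in> rvs X" for \<omega>
    using bspec[OF bspec[OF r, of "\<lambda>_. \<omega>"] measurable_ident] by simp
  moreover have "(\<lambda>(\<omega>, \<omega>'). F \<omega> \<omega>') \<circ> \<alpha> \<in> rvs X"
    if "\<alpha> \<in> rvs (prod_qus omega_qus omega_qus)" for \<alpha>
  proof -
    have "(\<lambda>\<omega>. F ((fst \<circ> \<alpha>) \<omega>) ((snd \<circ> \<alpha>) \<omega>)) \<in> rvs X"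
      using r that unfolding prod_qus_simps rvs_omega by blast
    then show ?thesis
      by (simp add: comp_def case_prod_beta)
  qed
  ultimately show "F \<in> fun_rvs X"
    using rvs_in_qcarrier[OF X F] unfolding fun_rvs_def qmeasurable_def by auto
qed

text \<open>Interleaving coordinates identifies the square of the cube with the cube. The pair of
  projections \<open>p\<close>, \<open>q\<close> is an admissible random variable, so it pulls
  \<open>D\<close> back to a universally measurable set, and pulling this back along the Borel map
  \<open>pr\<close> returns \<open>D\<close>.\<close>

lemma sets_induced_prod_omega:
  "sets (induced (prod_qus omega_qus omega_qus)) \<subseteq> sets (univ_measurable (borel_omega \<Otimes>\<^sub>M borel_omega))"
proof
  fix D assume D: "D \<in> sets (induced (prod_qus omega_qus omega_qus))"
  define p q where "p w = mk_omega (\<lambda>n. Rep_omega w (2 * n))"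
    and "q w = mk_omega (\<lambda>n. Rep_omega w (2 * n + 1))" for w
  define pr where "pr = (\<lambda>(v, w). mk_omega (\<lambda>n. if even n then Rep_omega v (n div 2) else Rep_omega w (n div 2)))"
  have clamp: "max 0 (min 1 (Rep_omega v n)) = Rep_omega v n" for v n
    using Rep_mk_omega[of "Rep_omega v" n] by (simp add: mk_omega_Rep)
  have pq: "(p (pr z), q (pr z)) = z" for z
    by (cases z) (simp add: p_def q_def pr_def Rep_mk_omega clamp mk_omega_Rep)
  have "p \<in> borel_omega \<rightarrow>\<^sub>M borel_omega" "q \<in> borel_omega \<rightarrow>\<^sub>M borel_omega"
    unfolding p_def q_def by (rule measurable_mk_omega, rule measurable_Rep_omega)+
  then have "p \<in> B_omega \<rightarrow>\<^sub>M B_omega" "q \<in> B_omega \<rightarrow>\<^sub>M B_omega"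
    by (blast intro: measurable_univ_measurable_cod[OF measurable_univ_measurable_dom])+
  then have pqD: "(\<lambda>w. (p w, q w)) -` D \<in> sets B_omega"
    using D unfolding sets_induced[OF quasi_universal_prod[OF quasi_universal_omega quasi_universal_omega]]
    by (simp add: comp_def)
  have "pr \<in> univ_measurable (borel_omega \<Otimes>\<^sub>M borel_omega) \<rightarrow>\<^sub>M B_omega"
  proof (rule measurable_univ_measurable_cod, rule measurable_univ_measurable_dom)
    note measurable_Rep_omega[measurable]
    show "pr \<in> borel_omega \<Otimes>\<^sub>M borel_omega \<rightarrow>\<^sub>M borel_omega"
      unfolding pr_def case_prod_beta
    proof (rule measurable_mk_omega)
      fix n
      show "(\<lambda>z. if even n then Rep_omega (fst z) (n div 2) else Rep_omega (snd z) (n div 2))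
          \<in> borel_measurable (borel_omega \<Otimes>\<^sub>M borel_omega)"
        by (cases "even n") simp_all
    qed
  qed
  from measurable_sets[OF this pqD]
  have "pr -` ((\<lambda>w. (p w, q w)) -` D) \<inter> space (borel_omega \<Otimes>\<^sub>M borel_omega)
      \<in> sets (univ_measurable (borel_omega \<Otimes>\<^sub>M borel_omega))"
    by (simp only: space_univ_measurable)
  also have "pr -` ((\<lambda>w. (p w, q w)) -` D) \<inter> space (borel_omega \<Otimes>\<^sub>M borel_omega) = D"
    by (simp add: vimage_def pq space_pair_measure)
  finally show "D \<in> sets (univ_measurable (borel_omega \<Otimes>\<^sub>M borel_omega))" .
qed

section \<open>Kernels, push-forwards and the section condition\<close>

lemma qcarrier_G_iff: "\<mu> \<in> qcarrier (G_space X) \<longleftrightarrow> prob_space \<mu> \<and> sets \<mu> = sets (induced X)"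
  by (simp add: G_space_def Let_def)

lemma rvs_G_iff:
  "\<kappa> \<in> rvs (G_space X) \<longleftrightarrow> (\<forall>\<omega>. \<kappa> \<omega> \<in> qcarrier (G_space X)) \<and>
     (\<forall>A\<in>sets (induced X). (\<lambda>\<omega>. measure (\<kappa> \<omega>) A) \<in> borel_measurable B_omega)"
  by (simp add: G_space_def Let_def)

lemma quasi_universal_G: "quasi_universal_space (G_space X)"
proof -
  have "\<kappa> \<circ> \<Phi> \<in> rvs (G_space X)"
    if "\<kappa> \<in> rvs (G_space X)" "\<Phi> \<in> B_omega \<rightarrow>\<^sub>M B_omega" for \<kappa> \<Phi>
    using that(1) measurable_compose[OF that(2)] unfolding rvs_G_iff comp_def by blast
  then show ?thesis
    unfolding quasi_universal_space_def by (auto simp: rvs_G_iff)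
qed

lemma push_in_G:
  assumes "quasi_universal_space X" "\<alpha> \<in> rvs X" "P \<in> qcarrier (G_space omega_qus)"
  shows "push X \<alpha> P \<in> qcarrier (G_space X)"
proof -
  have "\<alpha> \<in> P \<rightarrow>\<^sub>M induced X"
    using assms measurable_rv by (simp add: qcarrier_G_iff cong: measurable_cong_sets)
  then show ?thesis
    using assms(3) by (simp add: qcarrier_G_iff push_def prob_space.prob_space_distr)
qed

lemma measure_push:
  assumes "quasi_universal_space X" "\<alpha> \<in> rvs X" "P \<in> qcarrier (G_space omega_qus)"
    "A \<in> sets (induced X)"
  shows "measure (push X \<alpha> P) A = measure P (\<alpha> -` A)"
proof -
  have "\<alpha> \<in> P \<rightarrow>\<^sub>M induced X"
    using assms measurable_rv by (simp add: qcarrier_G_iff cong: measurable_cong_sets)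
  moreover have "space P = UNIV"
    using assms(3) sets_eq_imp_space_eq[of P] by (auto simp: qcarrier_G_iff)
  ultimately show ?thesis
    using assms(4) by (simp add: push_def measure_distr)
qed

lemma push_push:
  assumes X: "quasi_universal_space X" and \<alpha>: "\<alpha> \<in> rvs X"
    and \<phi>: "\<phi> \<in> B_omega \<rightarrow>\<^sub>M B_omega" and P: "P \<in> qcarrier (G_space omega_qus)"
  shows "push X \<alpha> (push omega_qus \<phi> P) = push X (\<alpha> \<circ> \<phi>) P"
proof -
  have "\<phi> \<in> P \<rightarrow>\<^sub>M induced omega_qus"
    using measurable_rv[OF quasi_universal_omega, of \<phi>] \<phi> P
    by (simp add: qcarrier_G_iff cong: measurable_cong_sets)
  then show ?thesis
    unfolding push_def by (rule distr_distr[OF measurable_rv[OF X \<alpha>]])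
qed

lemma measurable_G_omega_section:
  assumes \<kappa>: "\<kappa> \<in> rvs (G_space omega_qus)"
    and D: "D \<in> sets (induced (prod_qus omega_qus omega_qus))"
  shows "(\<lambda>\<omega>. measure (\<kappa> \<omega>) (Pair \<omega> -` D)) \<in> borel_measurable B_omega"
proof (rule measurable_kernel_section)
  show "prob_space (\<kappa> \<omega>)" "sets (\<kappa> \<omega>) = sets B_omega" for \<omega>
    using \<kappa> by (simp_all add: rvs_G_iff qcarrier_G_iff sets_induced_omega)
  show "(\<lambda>\<omega>. measure (\<kappa> \<omega>) A) \<in> borel_measurable B_omega" if "A \<in> sets borel_omega" for A
    using \<kappa> that sets_univ_measurable_superset by (auto simp: rvs_G_iff sets_induced_omega)
  show "D \<in> sets (univ_measurable (borel_omega \<Otimes>\<^sub>M borel_omega))"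
    using D sets_induced_prod_omega by blast
qed

text \<open>The mass of \<open>A\<close> at \<omega> is the mass under
  \<open>\<kappa> \<omega>\<close> of the section at \<omega> of the preimage of \<open>A\<close>
  under the uncurried \<open>F\<close>, so measurability of sections applies.\<close>

lemma push_rv_in_G:
  assumes X: "quasi_universal_space X" and F: "F \<in> fun_rvs X" and \<kappa>: "\<kappa> \<in> rvs (G_space omega_qus)"
  shows "(\<lambda>\<omega>. push X (F \<omega>) (\<kappa> \<omega>)) \<in> rvs (G_space X)"
  unfolding rvs_G_iff
proof (intro conjI allI ballI)
  have F': "F \<omega> \<in> rvs X" for \<omega>
    using F by (simp add: fun_rvs_def)
  have \<kappa>': "\<kappa> \<omega> \<in> qcarrier (G_space omega_qus)" for \<omega>
    using \<kappa> by (simp add: rvs_G_iff)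
  show "push X (F \<omega>) (\<kappa> \<omega>) \<in> qcarrier (G_space X)" for \<omega>
    by (rule push_in_G[OF X F' \<kappa>'])
  fix A assume A: "A \<in> sets (induced X)"
  have "(\<lambda>(\<omega>, \<omega>'). F \<omega> \<omega>') \<in> qmeasurable (prod_qus omega_qus omega_qus) X"
    using F by (simp add: fun_rvs_def)
  from measurable_sets[OF measurable_induced[OF quasi_universal_prod[OF quasi_universal_omega quasi_universal_omega] X this] A]
  have "(\<lambda>(\<omega>, \<omega>'). F \<omega> \<omega>') -` A \<in> sets (induced (prod_qus omega_qus omega_qus))"
    by simp
  from measurable_G_omega_section[OF \<kappa> this]
  show "(\<lambda>\<omega>. measure (push X (F \<omega>) (\<kappa> \<omega>)) A) \<in> borel_measurable B_omega"
    by (simp add: measure_push[OF X F' \<kappa>' A] vimage_def)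
qed

lemma qcarrier_Q_iff:
  "\<mu> \<in> qcarrier (Q_space X) \<longleftrightarrow> \<mu> \<in> qcarrier (G_space X) \<and>
     (\<forall>D\<in>sets (induced (prod_qus omega_qus X)).
        (\<lambda>\<omega>. measure \<mu> (Pair \<omega> -` D)) \<in> borel_measurable B_omega)"
  by (simp add: Q_space_def Let_def)

lemma rvs_Q_iff:
  "\<kappa> \<in> rvs (Q_space X) \<longleftrightarrow> (\<forall>\<omega>. \<kappa> \<omega> \<in> qcarrier (Q_space X)) \<and>
     (\<forall>\<Phi>\<in>B_omega \<rightarrow>\<^sub>M B_omega. \<forall>D\<in>sets (induced (prod_qus omega_qus X)).
        (\<lambda>\<omega>. measure (\<kappa> (\<Phi> \<omega>)) (Pair \<omega> -` D)) \<in> borel_measurable B_omega)"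
  by (simp add: Q_space_def Let_def)

text \<open>Reparametrizing a kernel by \<Phi> gives a kernel again, so \<open>sec\<close> already
  covers the condition with \<Phi>. Conversely, \<open>UNIV \<times> A\<close> has constant section
  \<open>A\<close>, which with \<Phi> the identity returns ordinary kernel measurability.\<close>

lemma Q_eq_G_if_sections:
  assumes X: "quasi_universal_space X"
    and sec: "\<And>\<kappa> D. \<kappa> \<in> rvs (G_space X) \<Longrightarrow> D \<in> sets (induced (prod_qus omega_qus X)) \<Longrightarrow>
      (\<lambda>\<omega>. measure (\<kappa> \<omega>) (Pair \<omega> -` D)) \<in> borel_measurable B_omega"
  shows "Q_space X = G_space X"
proof (rule prod_eqI)
  note G = quasi_universal_G[of X]
  show c: "qcarrier (Q_space X) = qcarrier (G_space X)"
    \<comment> \<open>A single measure is treated as a constant kernel.\<close>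
    using sec[OF const_in_rvs[OF G]] by (auto simp: qcarrier_Q_iff)
  have "\<kappa> \<in> rvs (Q_space X) \<longleftrightarrow> \<kappa> \<in> rvs (G_space X)" for \<kappa>
  proof
    assume \<kappa>: "\<kappa> \<in> rvs (G_space X)"
    show "\<kappa> \<in> rvs (Q_space X)"
      unfolding rvs_Q_iff c
      using rvs_in_qcarrier[OF G \<kappa>] sec[OF comp_in_rvs[OF G \<kappa>]] by blast
  next
    assume \<kappa>: "\<kappa> \<in> rvs (Q_space X)"
    have "(\<lambda>\<omega>. measure (\<kappa> \<omega>) A) \<in> borel_measurable B_omega" if A: "A \<in> sets (induced X)" for A
    proof -
      have "snd \<in> qmeasurable (prod_qus omega_qus X) X"
        by (auto simp: qmeasurable_def)
      from measurable_sets[OF measurable_induced[OF quasi_universal_prod[OF quasi_universal_omega X] X this] A]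
      have "UNIV \<times> A \<in> sets (induced (prod_qus omega_qus X))"
        using sets.sets_into_space[OF A] by (simp add: snd_vimage_eq_Times Times_Int_Times Int_absorb2)
      then have "(\<lambda>\<omega>. measure (\<kappa> (id \<omega>)) (Pair \<omega> -` (UNIV \<times> A))) \<in> borel_measurable B_omega"
        using \<kappa> measurable_ident unfolding rvs_Q_iff by blast
      then show ?thesis
        by (simp add: vimage_def)
    qed
    then show "\<kappa> \<in> rvs (G_space X)"
      using \<kappa> c by (simp add: rvs_Q_iff rvs_G_iff)
  qed
  then show "rvs (Q_space X) = rvs (G_space X)"
    by blast
qed

lemma Q_omega: "Q_space omega_qus = G_space omega_qus"
  by (rule Q_eq_G_if_sections[OF quasi_universal_omega measurable_G_omega_section])

lemma cdf_code_qmeasurable: "cdf_code \<in> qmeasurable (G_space omega_qus) omega_qus"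
proof -
  have "cdf_code \<circ> \<kappa> \<in> B_omega \<rightarrow>\<^sub>M B_omega" if \<kappa>: "\<kappa> \<in> rvs (G_space omega_qus)" for \<kappa>
    unfolding comp_def cdf_code_def
  proof (rule measurable_univ_measurable_cod, rule measurable_mk_omega)
    fix n
    have "{w. code w \<le> rat_enum n} \<in> sets borel_omega"
      using measurable_sets[OF measurable_code, of "{..rat_enum n}"] by (simp add: vimage_def)
    then show "(\<lambda>\<omega>. measure (\<kappa> \<omega>) {w. code w \<le> rat_enum n}) \<in> borel_measurable B_omega"
      using \<kappa> sets_univ_measurable_superset by (auto simp: rvs_G_iff sets_induced_omega)
  qed
  then show ?thesis
    by (simp add: qmeasurable_def)
qed

lemma noise_in_G: "noise \<in> qcarrier (G_space omega_qus)"
  by (simp add: qcarrier_G_iff prob_space_noise sets_noise sets_induced_omega)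

lemma push_randomizer:
  assumes "\<mu> \<in> qcarrier (G_space omega_qus)"
  shows "push omega_qus (randomizer (cdf_code \<mu>)) noise = \<mu>"
  using assms distr_noise_randomizer[of \<mu>]
  by (simp add: push_def qcarrier_G_iff sets_induced_omega cong: distr_cong)

lemma randomizer_fun_rvs:
  assumes "f \<in> B_omega \<rightarrow>\<^sub>M B_omega"
  shows "(\<lambda>\<omega>. randomizer (f \<omega>)) \<in> fun_rvs omega_qus"
  unfolding fun_rvs_iff[OF quasi_universal_omega] rvs_omega
proof (intro ballI)
  fix \<alpha> \<beta> assume \<alpha>: "\<alpha> \<in> B_omega \<rightarrow>\<^sub>M B_omega" and \<beta>: "\<beta> \<in> B_omega \<rightarrow>\<^sub>M B_omega"
  show "(\<lambda>\<omega>. randomizer (f (\<alpha> \<omega>)) (\<beta> \<omega>)) \<in> B_omega \<rightarrow>\<^sub>M B_omega"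
    using measurable_univ_measurable_weaken[OF measurable_compose[OF \<alpha> assms]]
      measurable_univ_measurable_weaken[OF \<beta>]
    by (rule measurable_univ_measurable_cod[OF measurable_randomizer])
qed

section \<open>Transfer from the sample space to its retracts\<close>

locale omega_retract =
  fixes X :: "'a qus" and i r
  assumes X: "quasi_universal_space X"
    and i: "i \<in> qmeasurable X omega_qus"
    and r: "r \<in> qmeasurable omega_qus X"
    and r_i: "x \<in> qcarrier X \<Longrightarrow> r (i x) = x"
begin

text \<open>Transport along \<open>i\<close>; since \<open>r\<close> undoes \<open>i\<close> on the
  carrier, pushing along \<open>r\<close> undoes this transport. It is written with
  \<open>distr\<close> because \<open>push\<close> starts from measures on
  \<open>omega\<close>.\<close>

definition emb :: "'a measure \<Rightarrow> omega measure" where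
  "emb \<mu> = distr \<mu> (induced omega_qus) i"

lemma r_rv: "r \<in> rvs X"
  using r rvs_eq_qmeasurable[OF X] by simp

lemma measurable_i: "\<mu> \<in> qcarrier (G_space X) \<Longrightarrow> i \<in> \<mu> \<rightarrow>\<^sub>M induced omega_qus"
  using measurable_induced[OF X quasi_universal_omega i]
  by (simp add: qcarrier_G_iff cong: measurable_cong_sets)

lemma emb_in_G: "\<mu> \<in> qcarrier (G_space X) \<Longrightarrow> emb \<mu> \<in> qcarrier (G_space omega_qus)"
  using measurable_i[of \<mu>] by (simp add: qcarrier_G_iff emb_def prob_space.prob_space_distr)

lemma push_emb:
  assumes "\<mu> \<in> qcarrier (G_space X)"
  shows "push X r (emb \<mu>) = \<mu>"
proof -
  have \<mu>: "sets \<mu> = sets (induced X)" "space \<mu> = qcarrier X"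
    using assms sets_eq_imp_space_eq[of \<mu> "induced X"] by (auto simp: qcarrier_G_iff)
  have "push X r (emb \<mu>) = distr \<mu> (induced X) (r \<circ> i)"
    unfolding push_def emb_def
    by (rule distr_distr[OF measurable_rv[OF X r_rv] measurable_i[OF assms]])
  also have "\<dots> = distr \<mu> \<mu> (\<lambda>x. x)"
    using \<mu> by (intro distr_cong) (auto simp: r_i)
  finally show ?thesis
    by simp
qed

lemma measure_emb:
  assumes "\<mu> \<in> qcarrier (G_space X)" "A \<in> sets B_omega"
  shows "measure (emb \<mu>) A = measure \<mu> (i -` A \<inter> qcarrier X)"
  using assms measurable_i[OF assms(1)] sets_eq_imp_space_eq[of \<mu> "induced X"]
  by (simp add: emb_def measure_distr sets_induced_omega qcarrier_G_iff)

lemma emb_qmeasurable: "emb \<in> qmeasurable (G_space X) (G_space omega_qus)"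
proof -
  have "emb \<circ> \<kappa> \<in> rvs (G_space omega_qus)" if \<kappa>: "\<kappa> \<in> rvs (G_space X)" for \<kappa>
    unfolding rvs_G_iff
  proof (intro conjI allI ballI)
    have c: "\<kappa> \<omega> \<in> qcarrier (G_space X)" for \<omega>
      using \<kappa> by (simp add: rvs_G_iff)
    show "(emb \<circ> \<kappa>) \<omega> \<in> qcarrier (G_space omega_qus)" for \<omega>
      using emb_in_G[OF c] by simp
    fix A assume A: "A \<in> sets (induced omega_qus)"
    have "i -` A \<inter> qcarrier X \<in> sets (induced X)"
      using measurable_sets[OF measurable_induced[OF X quasi_universal_omega i] A] by simp
    then show "(\<lambda>\<omega>. measure ((emb \<circ> \<kappa>) \<omega>) A) \<in> borel_measurable B_omega"
      using \<kappa> A measure_emb[OF c] by (simp add: rvs_G_iff sets_induced_omega)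
  qed
  then show ?thesis
    using emb_in_G by (auto simp: qmeasurable_def)
qed

lemma emb_rv: "\<kappa> \<in> rvs (G_space X) \<Longrightarrow> (\<lambda>\<omega>. emb (\<kappa> \<omega>)) \<in> rvs (G_space omega_qus)"
  using emb_qmeasurable by (auto simp: qmeasurable_def comp_def)

text \<open>Pulling \<open>D\<close> back along \<open>map_prod id r\<close> moves the question to
  the square of the cube. As \<open>r\<close> undoes \<open>i\<close> on the carrier, the
  transported kernel gives the pulled-back sections the same mass.\<close>

lemma Q_eq_G: "Q_space X = G_space X"
proof (rule Q_eq_G_if_sections[OF X])
  fix \<kappa> D assume \<kappa>: "\<kappa> \<in> rvs (G_space X)" and D: "D \<in> sets (induced (prod_qus omega_qus X))"
  let ?D = "map_prod id r -` D"
  have c: "\<kappa> \<omega> \<in> qcarrier (G_space X)" for \<omega>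
    using \<kappa> by (simp add: rvs_G_iff)
  have DX: "D \<subseteq> UNIV \<times> qcarrier X"
    using sets.sets_into_space[OF D] by simp
  have "map_prod id r \<in> qmeasurable (prod_qus omega_qus omega_qus) (prod_qus omega_qus X)"
    using r by (auto simp: qmeasurable_def comp_def)
  from measurable_sets[OF measurable_induced[OF quasi_universal_prod quasi_universal_prod this] D]
  have D': "?D \<in> sets (induced (prod_qus omega_qus omega_qus))"
    by (simp add: quasi_universal_omega X)
  have "measure (emb (\<kappa> \<omega>)) (Pair \<omega> -` ?D) = measure (\<kappa> \<omega>) (Pair \<omega> -` D)" for \<omega>
  proof -
    have "Pair \<omega> \<in> qmeasurable omega_qus (prod_qus omega_qus omega_qus)"
      by (simp add: qmeasurable_def comp_def)
    from measurable_sets[OF measurable_induced[OF quasi_universal_omega quasi_universal_prod this] D']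
    have "Pair \<omega> -` ?D \<in> sets B_omega"
      by (simp add: quasi_universal_omega sets_induced_omega)
    moreover have "i -` (Pair \<omega> -` ?D) \<inter> qcarrier X = Pair \<omega> -` D"
      using DX r_i by auto
    ultimately show ?thesis
      using measure_emb[OF c] by simp
  qed
  with measurable_G_omega_section[OF emb_rv[OF \<kappa>] D']
  show "(\<lambda>\<omega>. measure (\<kappa> \<omega>) (Pair \<omega> -` D)) \<in> borel_measurable B_omega"
    by simp
qed

text \<open>Every measure is the push along \<open>r\<close> of its own transport. As
  \<open>Q_space\<close> and \<open>G_space\<close> agree on \<open>omega_qus\<close>, this settles
  the carriers of all four spaces of push-forwards.\<close>

lemma qcarrier_pushes:
  "{push X \<alpha> P |\<alpha> P. \<alpha> \<in> rvs X \<and> P \<in> qcarrier (G_space omega_qus)} = qcarrier (G_space X)"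
proof (intro subset_antisym subsetI)
  fix \<mu> assume "\<mu> \<in> qcarrier (G_space X)"
  then show "\<mu> \<in> {push X \<alpha> P |\<alpha> P. \<alpha> \<in> rvs X \<and> P \<in> qcarrier (G_space omega_qus)}"
    using push_emb[of \<mu>] emb_in_G[of \<mu>] r_rv by force
qed (use push_in_G[OF X] in blast)

lemma const_fun_rvs: "\<alpha> \<in> rvs X \<Longrightarrow> (\<lambda>_. \<alpha>) \<in> fun_rvs X"
  using comp_in_rvs[OF X] by (simp add: fun_rvs_iff[OF X])

lemma comp_fun_rvs: "\<alpha> \<in> rvs X \<Longrightarrow> \<phi> \<in> fun_rvs omega_qus \<Longrightarrow> (\<lambda>\<omega>. \<alpha> \<circ> \<phi> \<omega>) \<in> fun_rvs X"
  using comp_in_rvs[OF X]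
  unfolding fun_rvs_iff[OF X] fun_rvs_iff[OF quasi_universal_omega] rvs_omega comp_def by blast

text \<open>Transport to the cube, encode by a distribution function, then resample: the dependence
  on \<omega> moves entirely into a map of the cube, while the measure being pushed is the fixed
  \<open>noise\<close>.\<close>

lemma rv_eq_push_randomizer:
  assumes "\<kappa> \<in> rvs (G_space X)"
  shows "\<kappa> = (\<lambda>\<omega>. push X r (push omega_qus (randomizer (cdf_code (emb (\<kappa> \<omega>)))) noise))"
    and "(\<lambda>\<omega>. randomizer (cdf_code (emb (\<kappa> \<omega>)))) \<in> fun_rvs omega_qus"
proof -
  have c: "\<kappa> \<omega> \<in> qcarrier (G_space X)" for \<omega>
    using assms by (simp add: rvs_G_iff)
  show "\<kappa> = (\<lambda>\<omega>. push X r (push omega_qus (randomizer (cdf_code (emb (\<kappa> \<omega>)))) noise))"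
    by (simp add: push_randomizer[OF emb_in_G[OF c]] push_emb[OF c])
  show "(\<lambda>\<omega>. randomizer (cdf_code (emb (\<kappa> \<omega>)))) \<in> fun_rvs omega_qus"
    using cdf_code_qmeasurable emb_rv[OF assms]
    by (intro randomizer_fun_rvs) (auto simp: qmeasurable_def comp_def)
qed

section \<open>The inclusions G, S, P, K and back to G of admissible random variables\<close>

lemma rvs_G_subset_S: "rvs (G_space X) \<subseteq> rvs (S_space X)"
proof
  fix \<kappa> assume \<kappa>: "\<kappa> \<in> rvs (G_space X)"
  show "\<kappa> \<in> rvs (S_space X)"
    unfolding S_space_def snd_conv mem_Collect_eq
    by (intro exI conjI) (rule rv_eq_push_randomizer[OF \<kappa>] r_rv noise_in_G)+
qed

lemma rvs_S_subset_P: "rvs (S_space X) \<subseteq> rvs (P_space X)"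
proof
  fix \<kappa> assume "\<kappa> \<in> rvs (S_space X)"
  then obtain \<alpha> \<phi> P where \<kappa>: "\<kappa> = (\<lambda>\<omega>. push X \<alpha> (push omega_qus (\<phi> \<omega>) P))"
    and *: "\<alpha> \<in> rvs X" "\<phi> \<in> fun_rvs omega_qus" "P \<in> qcarrier (G_space omega_qus)"
    by (auto simp: S_space_def)
  have "\<phi> \<omega> \<in> B_omega \<rightarrow>\<^sub>M B_omega" for \<omega>
    using *(2) by (simp add: fun_rvs_def)
  then have eq: "\<kappa> = (\<lambda>\<omega>. push X (\<alpha> \<circ> \<phi> \<omega>) P)"
    unfolding \<kappa> using push_push[OF X *(1) _ *(3)] by simp
  show "\<kappa> \<in> rvs (P_space X)"
    unfolding P_space_def snd_conv mem_Collect_eq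
    by (intro exI conjI) (rule eq comp_fun_rvs[OF *(1,2)] *(3))+
qed

lemma rvs_P_subset_K: "rvs (P_space X) \<subseteq> rvs (K_space X)"
proof
  fix \<kappa> assume "\<kappa> \<in> rvs (P_space X)"
  then obtain F P where \<kappa>: "\<kappa> = (\<lambda>\<omega>. push X (F \<omega>) P)"
    and F: "F \<in> fun_rvs X" and P: "P \<in> qcarrier (G_space omega_qus)"
    by (auto simp: P_space_def)
  show "\<kappa> \<in> rvs (K_space X)"
    unfolding K_space_def Q_omega snd_conv mem_Collect_eq
    by (intro exI conjI) (rule \<kappa> F const_in_rvs[OF quasi_universal_G P])+
qed

lemma rvs_K_subset_G: "rvs (K_space X) \<subseteq> rvs (G_space X)"
  unfolding K_space_def Q_omega snd_conv using push_rv_in_G[OF X] by blast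

text \<open>A fixed random variable is a constant family, which gives one inclusion; for the other,
  \<open>r\<close> is fixed and the transported kernel carries all the dependence on
  \<omega>.\<close>

lemma rvs_R_eq_G: "rvs (R_space X) = rvs (G_space X)"
proof (intro subset_antisym subsetI)
  fix \<kappa> assume "\<kappa> \<in> rvs (R_space X)"
  then show "\<kappa> \<in> rvs (G_space X)"
    unfolding R_space_def Q_omega snd_conv using push_rv_in_G[OF X const_fun_rvs] by blast
next
  fix \<kappa> assume \<kappa>: "\<kappa> \<in> rvs (G_space X)"
  have eq: "\<kappa> = (\<lambda>\<omega>. push X r (emb (\<kappa> \<omega>)))"
    using \<kappa> by (simp add: rvs_G_iff push_emb)
  show "\<kappa> \<in> rvs (R_space X)"
    unfolding R_space_def Q_omega snd_conv mem_Collect_eq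
    by (intro exI conjI) (rule eq r_rv emb_rv[OF \<kappa>])+
qed

lemma spaces_eq_G:
  "P_space X = G_space X" "K_space X = G_space X" "R_space X = G_space X" "S_space X = G_space X"
proof -
  have c: "qcarrier (P_space X) = qcarrier (G_space X)" "qcarrier (K_space X) = qcarrier (G_space X)"
    "qcarrier (R_space X) = qcarrier (G_space X)" "qcarrier (S_space X) = qcarrier (G_space X)"
    by (simp_all only: P_space_def K_space_def R_space_def S_space_def fst_conv Q_omega qcarrier_pushes)
  show "P_space X = G_space X" "K_space X = G_space X" "R_space X = G_space X" "S_space X = G_space X"
    using c rvs_G_subset_S rvs_S_subset_P rvs_P_subset_K rvs_K_subset_G rvs_R_eq_G
    by (blast intro: prod_eqI)+
qed

text \<open>The code of the transported measure is the embedding, and resampling from a code is the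
  retraction.\<close>

lemma standard_G: "standard_qus (G_space X)"
  unfolding standard_qus_def
proof (intro conjI disjI2 bexI ballI)
  let ?i = "\<lambda>\<mu>. cdf_code (emb \<mu>)" and ?r = "\<lambda>w. push X r (push omega_qus (randomizer w) noise)"
  show "quasi_universal_space (G_space X)" by (rule quasi_universal_G)
  show "?r (?i \<mu>) = \<mu>" if "\<mu> \<in> qcarrier (G_space X)" for \<mu>
    by (simp add: push_randomizer[OF emb_in_G[OF that]] push_emb[OF that])
  show "?i \<in> qmeasurable (G_space X) omega_qus"
    using emb_qmeasurable cdf_code_qmeasurable by (auto simp: qmeasurable_def comp_def)
  \<comment> \<open>With the identity as code map, \<open>?r\<close> is itself an admissible random
    variable of \<open>S_space X\<close>, hence of \<open>G_space X\<close>, and such variables are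
    the quasi-measurable maps out of \<open>omega_qus\<close>.\<close>
  have "(\<lambda>w. randomizer w) \<in> fun_rvs omega_qus"
    by (rule randomizer_fun_rvs[OF measurable_ident[unfolded id_def]])
  then have "?r \<in> rvs (S_space X)"
    unfolding S_space_def snd_conv mem_Collect_eq using r_rv noise_in_G by blast
  then show "?r \<in> qmeasurable omega_qus (G_space X)"
    by (simp add: spaces_eq_G rvs_eq_qmeasurable[OF quasi_universal_G])
qed

end

text \<open>The empty set carries no probability measure, and a map from the nonempty type
  \<open>omega\<close> has no values to take there.\<close>

lemma measure_spaces_of_empty:
  assumes X: "quasi_universal_space X" and empty: "qcarrier X = {}"
  shows "G_space X = ({}, {})" "Q_space X = ({}, {})" "P_space X = ({}, {})"
    "K_space X = ({}, {})" "R_space X = ({}, {})" "S_space X = ({}, {})"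
proof -
  have rvs: "rvs X = {}"
    using rvs_in_qcarrier[OF X] empty by auto
  have c: "qcarrier (G_space X) = {}"
    using prob_space.not_empty sets_eq_imp_space_eq[of _ "induced X"] empty
    by (fastforce simp: qcarrier_G_iff)
  show "G_space X = ({}, {})"
    using c by (intro prod_eqI) (auto simp: rvs_G_iff)
  show "Q_space X = ({}, {})"
    using c by (intro prod_eqI) (auto simp: rvs_Q_iff qcarrier_Q_iff)
  show "P_space X = ({}, {})" "K_space X = ({}, {})" "R_space X = ({}, {})" "S_space X = ({}, {})"
    by (simp_all add: P_space_def K_space_def R_space_def S_space_def fun_rvs_def rvs)
qed

theorem theoremF30:
  fixes X :: "'a qus"
  assumes "standard_qus X"
  shows "G_space X = Q_space X \<and> Q_space X = P_space X \<and> P_space X = K_space X \<and>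
         K_space X = R_space X \<and> R_space X = S_space X \<and>
         standard_qus (G_space X)"
proof (cases "qcarrier X = {}")
  case True
  have X: "quasi_universal_space X"
    using assms by (simp add: standard_qus_def)
  have "standard_qus (G_space X)"
    using quasi_universal_G[of X] by (simp add: standard_qus_def measure_spaces_of_empty[OF X True])
  then show ?thesis
    by (simp add: measure_spaces_of_empty[OF X True])
next
  case False
  then obtain i r where "omega_retract X i r"
    using assms unfolding standard_qus_def omega_retract_def by blast
  then interpret omega_retract X i r .
  show ?thesis
    using Q_eq_G spaces_eq_G standard_G by simp
qed

end
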